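(* Let $\{\mathcal{A}_n(x)\}_{n\ge0}$ be the scaled Atkin polynomials defined in the context. For every integer $n\ge 0$, $$\mathcal{A}_{n+1}(x)=\frac{(19/12)_n(11/12)_n}{(n+2)_n(-n)_n}\Bigg[-\frac{5}{12}\,{}_3F_2\left(\begin{matrix}-n,\ n+2,\ \frac{7}{12}\\ \frac{19}{12},\ 2\end{matrix}\,\Big|\,1\right)+\sum_{k=0}^n\frac{(-n)_k(n+2)_k}{(19/12)_k(11/12)_k}\,x^{k+1}\,E_{n,k}\Bigg],$$ where $$E_{n,k}=\frac{6}{5}\,{}_4F_3\left(\begin{matrix}k-n,\ n+k+2,\ \frac{11}{12},\ -\frac{5}{12}\\ k+\frac{11}{12},\ k+\frac{19}{12},\ 1\end{matrix}\,\Big|\,1\right)-\frac15\,{}_4F_3\left(\begin{matrix}k-n,\ n+k+2,\ -\frac{1}{12},\ -\frac{5}{12}\\ k+\frac{11}{12},\ k+\frac{19}{12},\ 1\end{matrix}\,\Big|\,1\right).$$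
   Context: Scaled Atkin polynomials: $\mathcal{A}_0(x)=1$, $\mathcal{A}_1(x)=x-\frac{5}{12}$, $\mathcal{A}_2(x)=x^2-\frac{205}{216}x+\frac{935}{10368}$, and for $n>1$ $$\mathcal{A}_{n+1}(x)=\left[x-\frac{2(n^2-29/144)}{4n^2-1}\right]\mathcal{A}_n(x)-\frac{(n-\frac{13}{12})(n-\frac{7}{12})(n-\frac{5}{12})(n+\frac1{12})}{2n(2n-1)^2(2n-2)}\mathcal{A}_{n-1}(x).$$ (They are related to the Atkin polynomials $A_n$ by $A_n(1728y)=1728^n\mathcal{A}_n(y)$.) Here $(a)_m=a(a+1)\cdots(a+m-1)$, $(a)_0=1$, and $${}_pF_q\left(\begin{matrix}a_1,\dots,a_p\\ b_1,\dots,b_q\end{matrix}\,\Big|\,z\right)=\sum_{m\ge0}\frac{(a_1)_m\cdots(a_p)_m}{(b_1)_m\cdots(b_q)_m}\frac{z^m}{m!}.$$ All series in the statement terminate, since they have a nonpositive integer upper parameter ($-n$ or $k-n$). *)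

theory Defs
  imports "HOL-Analysis.Analysis" "HOL-Computational_Algebra.Polynomial"
begin

text \<open>
  The recurrence holds for indices \<open>n > 1\<close> only (its last coefficient has the
  factor \<open>2 * n - 2\<close> in the denominator), so the first three polynomials are given
  explicitly and the recursive equation is used with \<open>n = k + 2\<close>.
\<close>

fun scaled_atkin :: "nat \<Rightarrow> complex poly" where
  "scaled_atkin 0 = 1"
| "scaled_atkin (Suc 0) = [:- (5 / 12), 1:]"
| "scaled_atkin (Suc (Suc 0)) = [:935 / 10368, - (205 / 216), 1:]"
| "scaled_atkin (Suc (Suc (Suc k))) =
     (let n = of_nat (k + 2) in
        [:- (2 * (n\<^sup>2 - 29 / 144) / (4 * n\<^sup>2 - 1)), 1:] * scaled_atkin (Suc (Suc k))
        - smult ((n - 13 / 12) * (n - 7 / 12) * (n - 5 / 12) * (n + 1 / 12)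
                 / (2 * n * (2 * n - 1)\<^sup>2 * (2 * n - 2)))
            (scaled_atkin (Suc k)))"

text \<open>
  The generalized hypergeometric series: \<open>as\<close> lists the upper and \<open>bs\<close> the lower
  parameters.
\<close>

definition hypergeometric :: "complex list \<Rightarrow> complex list \<Rightarrow> complex \<Rightarrow> complex" where
  "hypergeometric as bs z =
     (\<Sum>m. (\<Prod>a\<leftarrow>as. pochhammer a m) / (\<Prod>b\<leftarrow>bs. pochhammer b m) * (z ^ m / fact m))"

definition atkin_E :: "nat \<Rightarrow> nat \<Rightarrow> complex" where
  "atkin_E n k =
     6 / 5 * hypergeometric
       [of_nat k - of_nat n, of_nat n + of_nat k + 2, 11 / 12, - (5 / 12)]
       [of_nat k + 11 / 12, of_nat k + 19 / 12, 1] 1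
     - 1 / 5 * hypergeometric
       [of_nat k - of_nat n, of_nat n + of_nat k + 2, - (1 / 12), - (5 / 12)]
       [of_nat k + 11 / 12, of_nat k + 19 / 12, 1] 1"

end

theory Submission
  imports Defs
begin

text \<open>
  Reindexing the double sum by \<open>j = k + m\<close> turns the bracket into a constant plus
  \<open>\<Sum>j. b n j * \<phi> j x\<close>, where \<open>b n j\<close> is a hypergeometric term and the polynomials \<open>\<phi> j\<close> do
  not depend on \<open>n\<close> and satisfy \<open>\<phi> (j + 1) x = x * \<phi> j x + w (j + 1) * x\<close>. The three-term
  recurrence then holds coefficientwise in \<open>\<phi> j\<close> for \<open>j \<ge> 1\<close>. What remains concerns the
  coefficients of \<open>x\<^sup>0\<close> and \<open>x\<^sup>1\<close>: the first is a Saalschuetzian \<open>3F2\<close> and satisfies a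
  first-order recurrence by creative telescoping, and for the second the series involved combine
  to an indefinitely summable one.
\<close>

section \<open>Ingredients of the expansion\<close>

definition prefactor :: "nat \<Rightarrow> complex" where
  "prefactor n = pochhammer (19 / 12) n * pochhammer (11 / 12) n
      / (pochhammer (of_nat n + 2) n * pochhammer (- of_nat n) n)"

text \<open>
  The quotient of consecutive prefactors, as a function of the index \<open>t = n + 2\<close> that the
  recurrence uses.
\<close>

definition ratio :: "complex \<Rightarrow> complex" where
  "ratio t = - ((t - 5 / 12) * (t - 13 / 12) * t / (2 * (t - 1)\<^sup>2 * (2 * t - 1)))"

definition atkin_alpha :: "complex \<Rightarrow> complex" where
  "atkin_alpha t = 2 * (t\<^sup>2 - 29 / 144) / (4 * t\<^sup>2 - 1)"

definition atkin_beta :: "complex \<Rightarrow> complex" where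
  "atkin_beta t = (t - 13 / 12) * (t - 7 / 12) * (t - 5 / 12) * (t + 1 / 12)
     / (2 * t * (2 * t - 1)\<^sup>2 * (2 * t - 2))"

definition bcoeff :: "nat \<Rightarrow> nat \<Rightarrow> complex" where
  "bcoeff n j = pochhammer (- of_nat n) j * pochhammer (of_nat n + 2) j
      / (pochhammer (19 / 12) j * pochhammer (11 / 12) j)"

text \<open>The two \<open>4F3\<close> in \<open>atkin_E\<close> merge here:
  \<open>(11/12)_m = (-1/12)_m * (1 - 12 m)\<close>, hence \<open>6/5 * (11/12)_m - 1/5 * (-1/12)_m
  = (-1/12)_m * (1 - 72 m / 5)\<close>. One \<open>m!\<close> comes from the series, the other from
  the lower parameter 1.\<close>

definition weight :: "nat \<Rightarrow> complex" where
  "weight m = pochhammer (- (1 / 12)) m * pochhammer (- (5 / 12)) m * (1 - 72 * of_nat m / 5)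
      / (fact m)\<^sup>2"

definition phi :: "nat \<Rightarrow> complex \<Rightarrow> complex" where
  "phi j x = (\<Sum>m\<le>j. weight m * x ^ (j - m + 1))"

text \<open>The term of the \<open>3F2\<close>, simplified by
  \<open>(7/12)_j / (19/12)_j = (7/12) / (j + 7/12)\<close> and
  \<open>(2)_j = (j + 1)!\<close>.\<close>

definition saal_term :: "nat \<Rightarrow> nat \<Rightarrow> complex" where
  "saal_term n j = pochhammer (- of_nat n) j * pochhammer (of_nat n + 2) j
      / (fact j * fact (Suc j)) * ((7 / 12) / (of_nat j + 7 / 12))"

definition saal_sum :: "nat \<Rightarrow> complex" where
  "saal_sum n = (\<Sum>j\<le>n. saal_term n j)"

section \<open>Denominators that do not vanish\<close>

lemma of_nat_plus_neq_0:
  assumes "0 < q"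
  shows "of_nat n + complex_of_real q \<noteq> 0"
proof -
  have "of_nat n + complex_of_real q = complex_of_real (real n + q)"
    by simp
  moreover have "real n + q \<noteq> 0"
    using assms by linarith
  ultimately show ?thesis
    by (metis of_real_eq_0_iff)
qed

lemma of_nat_plus_fractions_neq_0:
  "of_nat n + 7 / 12 \<noteq> (0 :: complex)"
  "of_nat n + 11 / 12 \<noteq> (0 :: complex)"
  "of_nat n + 19 / 12 \<noteq> (0 :: complex)"
  using of_nat_plus_neq_0[of "7 / 12" n] of_nat_plus_neq_0[of "11 / 12" n]
    of_nat_plus_neq_0[of "19 / 12" n] by simp_all

lemma of_nat_plus_numeral_neq_0:
  "of_nat n + 1 \<noteq> (0 :: complex)" "of_nat n + numeral k \<noteq> (0 :: complex)"
  "2 * of_nat n + numeral k \<noteq> (0 :: complex)"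
  using of_nat_plus_neq_0[of 1 n] of_nat_plus_neq_0[of "numeral k" n]
    of_nat_plus_neq_0[of "numeral k" "2 * n"] by simp_all

lemma pochhammer_fraction_neq_0:
  "pochhammer (11 / 12) n \<noteq> (0 :: complex)" "pochhammer (19 / 12) n \<noteq> (0 :: complex)"
  using of_nat_plus_fractions_neq_0
  by (auto simp: pochhammer_eq_0_iff add_eq_0_iff)

lemma pochhammer_neg_of_nat_eq_0: "n < j \<Longrightarrow> pochhammer (- of_nat n :: complex) j = 0"
  by (simp add: pochhammer_of_nat_eq_0_iff)

section \<open>Index shifts of the hypergeometric terms\<close>

lemma prefactor_Suc: "prefactor (Suc n) = ratio (of_nat n + 2) * prefactor n"
proof -
  have a: "pochhammer (- of_nat (Suc n) :: complex) (Suc n)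
      = - ((of_nat n + 1) * pochhammer (- of_nat n) n)"
    by (simp add: pochhammer_rec algebra_simps)
  \<comment> \<open>Base and length both move with \<open>n\<close>; \<open>(n+2)_{n+2}\<close>
    contains both the old and the new symbol as factors.\<close>
  have "(of_nat n + 2) * pochhammer (of_nat n + 3 :: complex) (Suc n)
      = pochhammer (of_nat n + 2) (Suc (Suc n))"
    by (simp add: pochhammer_rec[of "of_nat n + 2"] add.assoc)
  also have "\<dots> = pochhammer (of_nat n + 2) n * (2 * of_nat n + 2) * (2 * of_nat n + 3)"
    by (simp add: pochhammer_Suc algebra_simps)
  finally have b: "pochhammer (of_nat (Suc n) + 2 :: complex) (Suc n)
      = pochhammer (of_nat n + 2) n * (2 * (of_nat n + 1)) * (2 * of_nat n + 3) / (of_nat n + 2)"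
    using of_nat_plus_numeral_neq_0(2)[of n "num.Bit0 num.One"]
    by (simp add: field_simps)
  have c: "of_nat n + 2 - 5 / 12 = of_nat n + (19 / 12 :: complex)"
    "of_nat n + 2 - 13 / 12 = of_nat n + (11 / 12 :: complex)"
    "of_nat n + 2 - 1 = (of_nat n + 1 :: complex)"
    "2 * (of_nat n + 2) - 1 = (2 * of_nat n + 3 :: complex)"
    by simp_all
  have d: "pochhammer q (Suc n) = pochhammer q n * (of_nat n + q)" for q :: complex
    by (simp add: pochhammer_Suc add.commute)
  show ?thesis
    unfolding prefactor_def ratio_def power2_eq_square a b c d[of "19 / 12"] d[of "11 / 12"]
    by (simp only: divide_divide_eq_right divide_divide_eq_left mult_minus_right mult_minus_left
        minus_divide_right[symmetric] minus_divide_left[symmetric] times_divide_eq_left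
        times_divide_eq_right ac_simps)
qed

text \<open>All four terms are multiples of \<open>(- n - 1)\<^sub>i * (n + 3)\<^sub>i\<close>.\<close>

lemma bcoeff_shifts:
  fixes n i :: nat
  defines "t \<equiv> of_nat n + 2" and "u \<equiv> of_nat i"
  defines "B \<equiv> bcoeff (Suc n) i / ((u + 19 / 12) * (u + 11 / 12))"
  shows "bcoeff (Suc n) i = B * ((u + 19 / 12) * (u + 11 / 12))"
    and "bcoeff (Suc n) (Suc i) = B * ((u - t + 1) * (t + 1 + u))"
    and "bcoeff (Suc (Suc n)) (Suc i) = - (B * (t * (t + 1 + u) * (t + 2 + u) / (t + 1)))"
    and "bcoeff n (Suc i) = - (B * ((u - t + 1) * (u - t + 2) * t / (t - 1)))"
proof -
  define X where "X = pochhammer (1 - t) i"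
  define Y where "Y = pochhammer (t + 1) i"
  define D where "D = pochhammer (19 / 12 :: complex) i * pochhammer (11 / 12) i"
  have t: "of_nat n = t - 2" "of_nat (Suc n) = t - 1" "of_nat (Suc (Suc n)) = t"
    "t - 1 + 2 = t + 1"
    by (simp_all add: t_def)
  have t1: "t - 1 = of_nat n + 1" "t + 1 = of_nat n + 3"
    by (simp_all add: t_def)
  have nz: "u + 19 / 12 \<noteq> 0" "u + 11 / 12 \<noteq> 0" "t - 1 \<noteq> 0" "t + 1 \<noteq> 0"
    unfolding u_def t1
    by (rule of_nat_plus_fractions_neq_0 of_nat_plus_numeral_neq_0)+
  have b: "bcoeff (Suc n) i = X * Y / D"
    unfolding bcoeff_def t by (simp add: X_def Y_def D_def)
  have B: "B = X * Y / (D * ((u + 19 / 12) * (u + 11 / 12)))"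
    by (simp add: B_def b)
  have DS: "pochhammer (19 / 12 :: complex) (Suc i) * pochhammer (11 / 12) (Suc i)
      = D * ((u + 19 / 12) * (u + 11 / 12))"
    by (simp add: pochhammer_Suc D_def u_def algebra_simps)
  have X1: "pochhammer (- of_nat (Suc n)) (Suc i) = X * (u - t + 1)"
    unfolding t by (simp add: pochhammer_Suc X_def u_def algebra_simps)
  have X2: "pochhammer (- of_nat (Suc (Suc n))) (Suc i) = - (t * X)"
    unfolding t by (simp add: pochhammer_rec X_def)
  \<comment> \<open>The base exceeds that of \<open>X\<close> by one, so the symbol is completed by
    its missing front factor, which is divided out afterwards.\<close>
  have "(1 - t) * pochhammer (2 - t) (Suc i) = pochhammer (1 - t) (Suc (Suc i))"
    by (simp add: pochhammer_rec[of "1 - t"])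
  also have "\<dots> = X * (u - t + 1) * (u - t + 2)"
    by (simp add: pochhammer_Suc X_def u_def algebra_simps)
  finally have X0: "pochhammer (- of_nat n) (Suc i) = - (X * (u - t + 1) * (u - t + 2) / (t - 1))"
    using nz(3) unfolding t by (simp add: divide_simps) (simp add: algebra_simps)
  have Y1: "pochhammer (of_nat (Suc n) + 2) (Suc i) = Y * (t + 1 + u)"
    unfolding t by (simp add: pochhammer_Suc Y_def u_def)
  have Y0: "pochhammer (of_nat n + 2) (Suc i) = t * Y"
    unfolding t by (simp add: pochhammer_rec Y_def)
  have "(t + 1) * pochhammer (t + 2) (Suc i) = pochhammer (t + 1) (Suc (Suc i))"
    by (simp add: pochhammer_rec[of "t + 1"] add.assoc)
  also have "\<dots> = Y * (t + 1 + u) * (t + 2 + u)"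
    by (simp add: pochhammer_Suc Y_def u_def algebra_simps)
  finally have Y2: "pochhammer (of_nat (Suc (Suc n)) + 2) (Suc i)
      = Y * (t + 1 + u) * (t + 2 + u) / (t + 1)"
    using nz(4) unfolding t by (simp add: nonzero_eq_divide_eq mult.commute)
  show "bcoeff (Suc n) i = B * ((u + 19 / 12) * (u + 11 / 12))"
    using nz by (simp add: B_def)
  show "bcoeff (Suc n) (Suc i) = B * ((u - t + 1) * (t + 1 + u))"
    unfolding bcoeff_def DS X1 Y1 B by simp
  show "bcoeff (Suc (Suc n)) (Suc i) = - (B * (t * (t + 1 + u) * (t + 2 + u) / (t + 1)))"
    unfolding bcoeff_def DS X2 Y2 B by (simp add: ac_simps)
  show "bcoeff n (Suc i) = - (B * ((u - t + 1) * (u - t + 2) * t / (t - 1)))"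
    unfolding bcoeff_def DS X0 Y0 B by (simp add: ac_simps)
qed

text \<open>The common denominator of the recurrence coefficients, after division by \<open>ratio t\<close>.\<close>

definition recip_denom :: "complex \<Rightarrow> complex" where
  "recip_denom t = 1 / (2 * t\<^sup>2 * (2 * t - 1) * (2 * t + 1))"

text \<open>The factor \<open>ratio t\<close> in \<open>atkin_beta t\<close> turns
  \<open>prefactor n\<close> into \<open>prefactor (Suc n)\<close> when \<open>t = n + 2\<close>.
  All three terms of the recurrence then share \<open>prefactor (Suc n) * recip_denom t\<close>, and
  polynomial identities remain.\<close>

lemma recurrence_coeffs:
  assumes "t \<noteq> 0" "t - 1 \<noteq> 0" "2 * t - 1 \<noteq> 0" "2 * t + 1 \<noteq> 0"
  shows "ratio (t + 1) = - (recip_denom t * ((t + 7 / 12) * (t - 1 / 12) * (t + 1) * (2 * t - 1)))"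
    and "atkin_alpha t = recip_denom t * (4 * (t\<^sup>2 - 29 / 144) * t\<^sup>2)"
    and "atkin_beta t
      = - (ratio t * recip_denom t * ((t - 7 / 12) * (t + 1 / 12) * (t - 1) * (2 * t + 1)))"
proof -
  have "ratio (t + 1) = - ((t + 7 / 12) * (t - 1 / 12) * (t + 1) / (2 * t\<^sup>2 * (2 * t + 1)))"
    by (simp add: ratio_def algebra_simps)
  then show "ratio (t + 1)
      = - (recip_denom t * ((t + 7 / 12) * (t - 1 / 12) * (t + 1) * (2 * t - 1)))"
    using assms by (simp add: recip_denom_def mult.assoc)
  have "4 * t\<^sup>2 - 1 = (2 * t - 1) * (2 * t + 1)"
    by (simp add: algebra_simps power2_eq_square)
  moreover have "2 * q / ((2 * t - 1) * (2 * t + 1)) = recip_denom t * (4 * q * t\<^sup>2)" for q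
    using assms(1) by (simp add: recip_denom_def mult.assoc)
  ultimately show "atkin_alpha t = recip_denom t * (4 * (t\<^sup>2 - 29 / 144) * t\<^sup>2)"
    unfolding atkin_alpha_def by (simp only:)
  \<comment> \<open>Naming the linear factors makes them atoms, so that \<open>simp\<close> cancels
    them instead of multiplying them out.\<close>
  define a b c d e f g where abcd: "a = t - 13 / 12" "b = t - 7 / 12" "c = t - 5 / 12" "d = t + 1 / 12"
    "e = 2 * t - 1" "f = 2 * t + 1" "g = t - 1"
  have nz: "e \<noteq> 0" "f \<noteq> 0" "g \<noteq> 0" "2 * t - 2 = 2 * g"
    using assms by (simp_all add: abcd)
  show "atkin_beta t
      = - (ratio t * recip_denom t * ((t - 7 / 12) * (t + 1 / 12) * (t - 1) * (2 * t + 1)))"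
    unfolding atkin_beta_def recip_denom_def ratio_def nz(4) abcd[symmetric]
    using nz(1-3) assms(1) by (simp add: power2_eq_square ac_simps)
qed

section \<open>Polynomial identities left after clearing denominators\<close>

lemma poly_identity_bcoeff:
  fixes t u :: complex
  shows "(t + 7 / 12) * (t - 1 / 12) * (2 * t - 1) * (t + 1 + u) * (t + 2 + u)
    + 4 * (t\<^sup>2 - 29 / 144) * t * (u - t + 1) * (t + 1 + u)
    + (t - 7 / 12) * (t + 1 / 12) * (2 * t + 1) * (u - t + 1) * (u - t + 2)
    = 2 * t * (2 * t - 1) * (2 * t + 1) * (u + 19 / 12) * (u + 11 / 12)"
  by algebra

lemma poly_identity_const:
  fixes t :: complex
  shows "4 * (t\<^sup>2 - 29 / 144) * t
    = (2 * t - 1) * (t - 1 / 12) * (t + 5 / 12) + (t + 1 / 12) * (2 * t + 1) * (t - 5 / 12)"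
  by algebra

text \<open>The last summand is the defect in the coefficient of \<open>x\<close>; multiplied by
  \<open>recip_denom t\<close> it becomes \<open>7 / 144 / t\<^sup>2\<close>.\<close>

lemma poly_identity_linear:
  fixes t :: complex
  shows "4 * (t\<^sup>2 - 29 / 144) * t\<^sup>2
    = (t + 7 / 12) * (t - 1 / 12) * (t + 1) * (2 * t - 1)
    + (t - 7 / 12) * (t + 1 / 12) * (t - 1) * (2 * t + 1)
    + 7 / 72 * (2 * t - 1) * (2 * t + 1)"
  by algebra

section \<open>Two telescoping sums\<close>

lemma saal_sum_Suc:
  fixes n :: nat
  defines "t \<equiv> of_nat n + 2"
  shows "t * (t - 5 / 12) * saal_sum (Suc n) = (t - 1) * (t - 7 / 12) * saal_sum n"
proof -
  \<comment> \<open>\<open>G\<close> is the telescoping certificate. In terms of \<open>L\<close>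
    below, its difference is \<open>c * L * (- ((t - 1) * t))\<close>, and \<open>c\<close> is
    scaled to turn this into \<open>7/12 * (2 * t - 1) * L\<close>.\<close>
  define c where "c = - ((7 / 12) * (2 * t - 1) / ((t - 1) * t))"
  define G where "G j = c * (pochhammer (1 - t) j * pochhammer t j * of_nat j / (fact j)\<^sup>2)" for j
  have t: "of_nat n = t - 2" "of_nat (Suc n) = t - 1" "t - 1 + 2 = t + 1" "t - 2 + 2 = t"
    "- (t - 1) = 1 - t" "- (t - 2) = 2 - t"
    by (simp_all add: t_def)
  have t1: "t - 1 = of_nat n + 1"
    by (simp add: t_def)
  have nz: "t - 1 \<noteq> 0" "t \<noteq> 0"
    unfolding t1 by (rule of_nat_plus_numeral_neq_0) (simp add: t_def of_nat_plus_numeral_neq_0)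
  have step: "t * (t - 5 / 12) * saal_term (Suc n) j - (t - 1) * (t - 7 / 12) * saal_term n j
      = G (Suc j) - G j" for j
  proof -
    define u where "u = complex_of_nat j"
    define X where "X = pochhammer (1 - t) j"
    define Y where "Y = pochhammer t j"
    define q where "q = (7 / 12) / (u + 7 / 12)"
    define L where "L = X * Y / (fact j * fact (Suc j))"
    have u: "u + 7 / 12 \<noteq> 0" "u + 1 \<noteq> 0"
      unfolding u_def by (rule of_nat_plus_fractions_neq_0 of_nat_plus_numeral_neq_0)+
    have "(1 - t) * pochhammer (2 - t) j = X * (u + 1 - t)"
      using pochhammer_rec[of "1 - t" j] by (simp add: pochhammer_Suc X_def u_def algebra_simps)
    then have X0: "pochhammer (2 - t) j = X * (t - 1 - u) / (t - 1)"
      using nz by (simp add: divide_simps) (simp add: algebra_simps)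
    have "t * pochhammer (t + 1) j = Y * (t + u)"
      using pochhammer_rec[of t j] by (simp add: pochhammer_Suc Y_def u_def algebra_simps)
    then have Y1: "pochhammer (t + 1) j = Y * (t + u) / t"
      using nz by (simp add: nonzero_eq_divide_eq mult.commute)
    have F1: "saal_term (Suc n) j = L * ((t + u) / t) * q"
      unfolding saal_term_def t Y1 L_def X_def[symmetric] u_def[symmetric] q_def[symmetric]
      by (simp add: ac_simps del: fact_Suc)
    have F0: "saal_term n j = L * ((t - 1 - u) / (t - 1)) * q"
      unfolding saal_term_def t X0 L_def Y_def[symmetric] u_def[symmetric] q_def[symmetric]
      by (simp add: ac_simps del: fact_Suc)
    have fS: "fact (Suc j) = (u + 1) * fact j"
      by (simp add: u_def add.commute)
    have G1: "G (Suc j) = c * (L * ((u + 1 - t) * (t + u)))"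
    proof -
      have "pochhammer (1 - t) (Suc j) = X * (u + 1 - t)" "pochhammer t (Suc j) = Y * (t + u)"
        and uS: "of_nat (Suc j) = u + 1"
        by (simp_all add: pochhammer_Suc X_def Y_def u_def algebra_simps)
      then show ?thesis
        unfolding G_def L_def fS uS using u(2) by (simp add: power2_eq_square del: of_nat_Suc)
    qed
    have G0: "G j = c * (L * (u * (u + 1)))"
      unfolding G_def L_def fS using u(2) by (simp add: power2_eq_square X_def Y_def u_def)
    have cancel: "s * a * (L * (b / s) * q) = L * q * (a * b)" if "s \<noteq> 0" for s a b
      using that by simp
    have "t * (t - 5 / 12) * saal_term (Suc n) j - (t - 1) * (t - 7 / 12) * saal_term n j
        = L * q * ((t - 5 / 12) * (t + u) - (t - 7 / 12) * (t - 1 - u))"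
      unfolding F1 F0 cancel[OF nz(1)] cancel[OF nz(2)] by (simp only: right_diff_distrib)
    \<comment> \<open>The multipliers of the two sums are such that \<open>u + 7/12\<close> factors
      out here and cancels the denominator of \<open>q\<close>.\<close>
    also have "(t - 5 / 12) * (t + u) - (t - 7 / 12) * (t - 1 - u) = (2 * t - 1) * (u + 7 / 12)"
      by algebra
    also have "L * q * ((2 * t - 1) * (u + 7 / 12)) = L * (q * (u + 7 / 12)) * (2 * t - 1)"
      by (simp only: ac_simps)
    also have "q * (u + 7 / 12) = 7 / 12"
      using q_def u(1) by (simp only: nonzero_eq_divide_eq not_False_eq_True)
    also have "L * (7 / 12) * (2 * t - 1) = c * (L * (- ((t - 1) * t)))"
      using nz by (simp add: c_def)
    also have "- ((t - 1) * t) = (u + 1 - t) * (t + u) - u * (u + 1)"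
      by (simp add: algebra_simps)
    also have "c * (L * \<dots>) = G (Suc j) - G j"
      unfolding G1 G0 by (simp add: algebra_simps)
    finally show ?thesis .
  qed
  \<comment> \<open>A vanishing term brings both sums to the range
    \<open>j \<le> n + 1\<close>.\<close>
  have "saal_term n (Suc n) = 0"
    by (simp add: saal_term_def pochhammer_neg_of_nat_eq_0)
  then have "saal_sum n = (\<Sum>j\<le>Suc n. saal_term n j)"
    by (simp add: saal_sum_def)
  then have "t * (t - 5 / 12) * saal_sum (Suc n) - (t - 1) * (t - 7 / 12) * saal_sum n
      = (\<Sum>j\<le>Suc n. G (Suc j) - G j)"
    unfolding step[symmetric] by (simp add: saal_sum_def sum_subtractf sum_distrib_left del: sum.atMost_Suc)
  also have "\<dots> = G (Suc (Suc n)) - G 0"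
    by (simp only: lessThan_Suc_atMost[symmetric] sum_lessThan_telescope)
  also have "\<dots> = 0"
  proof -
    \<comment> \<open>\<open>G 0\<close> vanishes through its factor \<open>j\<close>, and
      \<open>G (n + 2)\<close> because \<open>(-n-1)_{n+2} = 0\<close>.\<close>
    have "1 - t = - of_nat (Suc n)"
      by (simp add: t_def)
    then show ?thesis
      unfolding G_def by (simp add: pochhammer_neg_of_nat_eq_0 del: of_nat_Suc)
  qed
  finally show ?thesis
    by simp
qed

text \<open>Multiplying the bracket by \<open>x\<close> produces the weight sum from
  \<open>phi_Suc\<close>, and \<open>- 5/12 * saal_sum n\<close> from the constant term. The terms
  of the combination lose the denominator \<open>i + 7/12\<close> and become multiples of
  differences of \<open>U\<close>.\<close>

lemma sum_bcoeff_weight: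
  "(\<Sum>i\<le>n. bcoeff n i * weight (Suc i)) + 5 / 12 * saal_sum n
     = - (7 / 144 / (of_nat n + 1)\<^sup>2)"
proof -
  define v where "v = complex_of_nat n"
  define U where "U i = pochhammer (- v) i * pochhammer (v + 2) i / (fact i)\<^sup>2" for i
  have v: "v + 1 \<noteq> 0"
    unfolding v_def by (rule of_nat_plus_numeral_neq_0)
  have step: "bcoeff n i * weight (Suc i) + 5 / 12 * saal_term n i
      = 7 / 144 / (v + 1)\<^sup>2 * (U (Suc i) - U i)" for i
  proof -
    define u where "u = complex_of_nat i"
    define q where "q = (7 / 12) / (u + 7 / 12)"
    \<comment> \<open>The constant \<open>5/144\<close> is the product of the front factors
      \<open>-1/12\<close> and \<open>-5/12\<close> of the two symbols in
      \<open>weight (Suc i)\<close>.\<close>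
    define r where "r = 5 / 144 * (1 - 72 * (u + 1) / 5)"
    define Z where "Z = pochhammer (- v) i * pochhammer (v + 2) i / (fact i)\<^sup>2"
    have u: "u + 7 / 12 \<noteq> 0" "u + 1 \<noteq> 0"
      unfolding u_def by (rule of_nat_plus_fractions_neq_0 of_nat_plus_numeral_neq_0)+
    have fS: "fact (Suc i) = (u + 1) * fact i"
      by (simp add: u_def add.commute)
    have "pochhammer (7 / 12) i * (u + 7 / 12) = 7 / 12 * pochhammer (19 / 12) i"
      using pochhammer_rec[of "7 / 12 :: complex" i] by (simp add: pochhammer_Suc u_def add.commute)
    then have p: "pochhammer (7 / 12) i = q * pochhammer (19 / 12) i"
      using u(1) unfolding q_def
      by (simp only: nonzero_eq_divide_eq times_divide_eq_left not_False_eq_True)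
    have "weight (Suc i) = pochhammer (11 / 12) i * pochhammer (7 / 12) i * r / (fact (Suc i))\<^sup>2"
      by (simp add: weight_def pochhammer_rec u_def r_def add.commute del: fact_Suc)
    then have "bcoeff n i * weight (Suc i)
        = Z * q * r / (u + 1)\<^sup>2"
      unfolding p fS using pochhammer_fraction_neq_0[of i]
      by (simp add: bcoeff_def Z_def v_def power_mult_distrib ac_simps)
    moreover have "saal_term n i = Z * q * (u + 1) / (u + 1)\<^sup>2"
      unfolding saal_term_def fS Z_def v_def u_def[symmetric] q_def[symmetric]
      using u(2) by (simp add: power2_eq_square ac_simps)
    ultimately have "bcoeff n i * weight (Suc i) + 5 / 12 * saal_term n i
        = Z * q * (r + 5 / 12 * (u + 1)) / (u + 1)\<^sup>2"
      by (simp only: distrib_left add_divide_distrib times_divide_eq_right mult.left_commute)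
    \<comment> \<open>The coefficient \<open>5/12\<close> is what makes this a multiple of
      \<open>u + 7/12\<close>.\<close>
    also have "r + 5 / 12 * (u + 1) = - (1 / 12) * (u + 7 / 12)"
      unfolding r_def by algebra
    also have "Z * q * (- (1 / 12) * (u + 7 / 12)) / (u + 1)\<^sup>2
        = - (1 / 12) * Z * (q * (u + 7 / 12)) / (u + 1)\<^sup>2"
      by (simp only: ac_simps)
    also have "q * (u + 7 / 12) = 7 / 12"
      using q_def u(1) by (simp only: nonzero_eq_divide_eq not_False_eq_True)
    also have "- (1 / 12) * Z * (7 / 12) / (u + 1)\<^sup>2 = - (7 / 144) * Z / (u + 1)\<^sup>2"
      by simp
    also have "\<dots> = 7 / 144 / (v + 1)\<^sup>2 * (Z * (- (v + 1)\<^sup>2) / (u + 1)\<^sup>2)"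
      using v by simp
    \<comment> \<open>The quotient of \<open>U (Suc i)\<close> by \<open>U i\<close> is
      \<open>(u - v) * (v + 2 + u) / (u + 1)\<^sup>2\<close>.\<close>
    also have "- (v + 1)\<^sup>2 = (u - v) * (v + 2 + u) - (u + 1)\<^sup>2"
      by (simp add: algebra_simps power2_eq_square)
    also have "Z * \<dots> / (u + 1)\<^sup>2 = U (Suc i) - U i"
    proof -
      have "U (Suc i) = Z * ((u - v) * (v + 2 + u)) / (u + 1)\<^sup>2"
      proof -
        have "pochhammer (- v) (Suc i) = pochhammer (- v) i * (u - v)"
          by (simp add: pochhammer_Suc u_def)
        moreover have "pochhammer (v + 2) (Suc i) = pochhammer (v + 2) i * (v + 2 + u)"
          by (simp add: pochhammer_Suc u_def)
        ultimately show ?thesis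
          unfolding U_def fS Z_def power_mult_distrib
          by (simp only: times_divide_eq_left times_divide_eq_right divide_divide_eq_left ac_simps)
      qed
      moreover have "U i = Z * (u + 1)\<^sup>2 / (u + 1)\<^sup>2"
        using u(2) by (simp add: U_def Z_def)
      ultimately show ?thesis
        by (simp only: right_diff_distrib diff_divide_distrib)
    qed
    finally show ?thesis .
  qed
  have "(\<Sum>i\<le>n. bcoeff n i * weight (Suc i)) + 5 / 12 * saal_sum n
      = 7 / 144 / (v + 1)\<^sup>2 * (\<Sum>i\<le>n. U (Suc i) - U i)"
    by (simp only: saal_sum_def sum_distrib_left sum.distrib[symmetric] step)
  also have "(\<Sum>i\<le>n. U (Suc i) - U i) = U (Suc n) - U 0"
    by (simp only: lessThan_Suc_atMost[symmetric] sum_lessThan_telescope)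
  also have "\<dots> = - 1"
    by (simp add: U_def v_def pochhammer_neg_of_nat_eq_0)
  finally show ?thesis
    by (simp add: v_def)
qed

section \<open>Recurrences for the separate coefficients\<close>

lemma phi_0: "phi 0 x = x"
  by (simp add: phi_def weight_def)

lemma phi_Suc: "phi (Suc j) x = x * phi j x + weight (Suc j) * x"
  by (simp add: phi_def sum_distrib_left Suc_diff_le ac_simps)

lemma shifted_index_neq_0:
  fixes n :: nat
  defines "t \<equiv> complex_of_nat n + 2"
  shows "t \<noteq> 0" "t - 1 \<noteq> 0" "t + 1 \<noteq> 0" "2 * t - 1 \<noteq> 0" "2 * t + 1 \<noteq> 0"
    "t - 5 / 12 \<noteq> 0" "t + 7 / 12 \<noteq> 0"
proof -
  have "t = of_nat n + 2" "t - 1 = of_nat n + 1" "t + 1 = of_nat n + 3"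
    "2 * t - 1 = 2 * of_nat n + 3" "2 * t + 1 = 2 * of_nat n + 5"
    "t - 5 / 12 = of_nat n + 19 / 12" "t + 7 / 12 = of_nat (Suc n) + 19 / 12"
    by (simp_all add: t_def)
  then show "t \<noteq> 0" "t - 1 \<noteq> 0" "t + 1 \<noteq> 0" "2 * t - 1 \<noteq> 0" "2 * t + 1 \<noteq> 0"
    "t - 5 / 12 \<noteq> 0" "t + 7 / 12 \<noteq> 0"
    by (simp_all only: of_nat_plus_numeral_neq_0 of_nat_plus_fractions_neq_0 not_False_eq_True)
qed

lemma recip_denom_cancel:
  assumes "t \<noteq> 0" "2 * t - 1 \<noteq> 0" "2 * t + 1 \<noteq> 0"
  shows "recip_denom t * (2 * t\<^sup>2 * (2 * t - 1) * (2 * t + 1)) = 1"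
  using assms by (simp add: recip_denom_def)

text \<open>Comparison of the coefficients of \<open>phi (Suc i)\<close>: the right side is what
  \<open>x * phi i\<close> contributes. Up to the common factor \<open>K * M * t\<close> it is
  \<open>poly_identity_bcoeff\<close>.\<close>

lemma bcoeff_recurrence:
  fixes n i :: nat
  defines "t \<equiv> of_nat n + 2"
  shows "prefactor (Suc (Suc n)) * bcoeff (Suc (Suc n)) (Suc i)
      + atkin_alpha t * (prefactor (Suc n) * bcoeff (Suc n) (Suc i))
      + atkin_beta t * (prefactor n * bcoeff n (Suc i))
    = prefactor (Suc n) * bcoeff (Suc n) i"
proof -
  define u where "u = complex_of_nat i"
  define B where "B = bcoeff (Suc n) i / ((u + 19 / 12) * (u + 11 / 12))"
  define M where "M = recip_denom t"
  define K where "K = prefactor n * ratio t * B"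
  have nz: "t \<noteq> 0" "t - 1 \<noteq> 0" "t + 1 \<noteq> 0" "2 * t - 1 \<noteq> 0" "2 * t + 1 \<noteq> 0"
    unfolding t_def by (rule shifted_index_neq_0)+
  have M: "M * (2 * t\<^sup>2 * (2 * t - 1) * (2 * t + 1)) = 1"
    unfolding M_def using nz by (intro recip_denom_cancel)
  note b = bcoeff_shifts[of n i, folded u_def t_def, folded B_def]
  note rc = recurrence_coeffs[OF nz(1,2,4,5), folded M_def]
  have p1: "prefactor (Suc n) = ratio t * prefactor n"
    by (simp add: prefactor_Suc t_def)
  have t1: "of_nat (Suc n) + 2 = t + 1"
    by (simp add: t_def)
  have p2: "prefactor (Suc (Suc n)) = ratio (t + 1) * (ratio t * prefactor n)"
    unfolding prefactor_Suc[of "Suc n"] p1 t1 ..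
  \<comment> \<open>Stated for arbitrary factors, so that only \<open>t + 1\<close> and
    \<open>t - 1\<close> are cancelled and the products stay unexpanded.\<close>
  have c: "M * (a * (t + 1) * d) * (t * e * f / (t + 1)) = M * t * (a * d * e * f)"
    "M * (a * (t - 1) * d) * (e * f * t / (t - 1)) = M * t * (a * d * e * f)" for a d e f
    using nz(2,3) by simp_all
  have "prefactor (Suc (Suc n)) * bcoeff (Suc (Suc n)) (Suc i)
      = K * (M * ((t + 7 / 12) * (t - 1 / 12) * (t + 1) * (2 * t - 1))
          * (t * (t + 1 + u) * (t + 2 + u) / (t + 1)))"
    unfolding p2 b(3) rc(1) K_def by (simp only: minus_mult_minus ac_simps)
  also have "\<dots> = K * M * t * ((t + 7 / 12) * (t - 1 / 12) * (2 * t - 1) * (t + 1 + u) * (t + 2 + u))"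
    unfolding c by (simp only: mult.assoc)
  finally have T2: "prefactor (Suc (Suc n)) * bcoeff (Suc (Suc n)) (Suc i) = \<dots>" .
  have T1: "atkin_alpha t * (prefactor (Suc n) * bcoeff (Suc n) (Suc i))
      = K * M * t * (4 * (t\<^sup>2 - 29 / 144) * t * (u - t + 1) * (t + 1 + u))"
    unfolding p1 b(2) rc(2) K_def by (simp only: power2_eq_square[of t] ac_simps)
  have "atkin_beta t * (prefactor n * bcoeff n (Suc i))
      = K * (M * ((t - 7 / 12) * (t + 1 / 12) * (t - 1) * (2 * t + 1))
          * ((u - t + 1) * (u - t + 2) * t / (t - 1)))"
    unfolding b(4) rc(3) K_def by (simp only: minus_mult_minus ac_simps)
  also have "\<dots> = K * M * t * ((t - 7 / 12) * (t + 1 / 12) * (2 * t + 1) * (u - t + 1) * (u - t + 2))"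
    unfolding c by (simp only: mult.assoc)
  finally have T0: "atkin_beta t * (prefactor n * bcoeff n (Suc i)) = \<dots>" .
  have "prefactor (Suc (Suc n)) * bcoeff (Suc (Suc n)) (Suc i)
      + atkin_alpha t * (prefactor (Suc n) * bcoeff (Suc n) (Suc i))
      + atkin_beta t * (prefactor n * bcoeff n (Suc i))
    = K * M * t * (2 * t * (2 * t - 1) * (2 * t + 1) * (u + 19 / 12) * (u + 11 / 12))"
    unfolding T2 T1 T0 poly_identity_bcoeff[symmetric] by (simp only: distrib_left)
  also have "\<dots> = K * (M * (2 * t\<^sup>2 * (2 * t - 1) * (2 * t + 1))) * ((u + 19 / 12) * (u + 11 / 12))"
    by (simp only: power2_eq_square ac_simps)
  also have "\<dots> = prefactor (Suc n) * bcoeff (Suc n) i"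
    unfolding M p1 b(1) K_def by (simp only: mult_1_left ac_simps)
  finally show ?thesis .
qed

text \<open>The coefficient of \<open>x\<^sup>0\<close>, to which \<open>x\<close> times the bracket
  contributes nothing. By \<open>saal_sum_Suc\<close> both outer sums become multiples of
  \<open>saal_sum (Suc n)\<close>, which leaves \<open>poly_identity_const\<close>.\<close>

lemma const_recurrence:
  fixes n :: nat
  defines "t \<equiv> of_nat n + 2"
  shows "prefactor (Suc (Suc n)) * saal_sum (Suc (Suc n))
      + atkin_alpha t * (prefactor (Suc n) * saal_sum (Suc n))
      + atkin_beta t * (prefactor n * saal_sum n) = 0"
proof -
  define M where "M = recip_denom t"
  have nz: "t \<noteq> 0" "t - 1 \<noteq> 0" "t + 1 \<noteq> 0" "2 * t - 1 \<noteq> 0" "2 * t + 1 \<noteq> 0"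
      "t - 5 / 12 \<noteq> 0" "t + 7 / 12 \<noteq> 0"
    unfolding t_def by (rule shifted_index_neq_0)+
  note rc = recurrence_coeffs[OF nz(1,2,4,5), folded M_def]
  have p1: "prefactor (Suc n) = ratio t * prefactor n"
    by (simp add: prefactor_Suc t_def)
  have t1: "of_nat (Suc n) + 2 = t + 1" "t + 1 - 5 / 12 = t + 7 / 12" "t + 1 - 1 = t"
      "t + 1 - 7 / 12 = t + 5 / 12"
    by (simp_all add: t_def)
  have p2: "prefactor (Suc (Suc n)) = ratio (t + 1) * (ratio t * prefactor n)"
    unfolding prefactor_Suc[of "Suc n"] p1 t1 ..
  have s1: "(t - 1) * (t - 7 / 12) * saal_sum n = t * (t - 5 / 12) * saal_sum (Suc n)"
    using saal_sum_Suc[of n] by (simp add: t_def)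
  have s2: "(t + 1) * (t + 7 / 12) * saal_sum (Suc (Suc n)) = t * (t + 5 / 12) * saal_sum (Suc n)"
    using saal_sum_Suc[of "Suc n"] unfolding t1 .
  define K where "K = prefactor n * ratio t * M"
  have e2: "prefactor (Suc (Suc n)) * saal_sum (Suc (Suc n))
      = - (K * (2 * t - 1) * (t - 1 / 12) * ((t + 1) * (t + 7 / 12) * saal_sum (Suc (Suc n))))"
    unfolding p2 rc(1) K_def by (simp only: mult_minus_left mult_minus_right ac_simps)
  have e0: "atkin_beta t * (prefactor n * saal_sum n)
      = - (K * (2 * t + 1) * (t + 1 / 12) * ((t - 1) * (t - 7 / 12) * saal_sum n))"
    unfolding rc(3) K_def by (simp only: mult_minus_left mult_minus_right ac_simps)
  have e1: "atkin_alpha t * (prefactor (Suc n) * saal_sum (Suc n))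
      = K * t * saal_sum (Suc n) * (4 * (t\<^sup>2 - 29 / 144) * t)"
    unfolding rc(2) K_def p1 by (simp only: power2_eq_square[of t] ac_simps)
  show ?thesis
    unfolding e2 e1 e0 s1 s2 poly_identity_const by algebra
qed

text \<open>The coefficient of \<open>phi 0 x = x\<close>, where every \<open>bcoeff m 0\<close> is
  1. The right side is later cancelled by \<open>sum_bcoeff_weight\<close> at \<open>n + 1\<close>,
  since \<open>(n + 1) + 1 = t\<close>.\<close>

lemma linear_recurrence:
  fixes n :: nat
  defines "t \<equiv> of_nat n + 2"
  shows "prefactor (Suc (Suc n)) + atkin_alpha t * prefactor (Suc n) + atkin_beta t * prefactor n
    = prefactor (Suc n) * (7 / 144 / t\<^sup>2)"
proof -
  define M where "M = recip_denom t"
  define K where "K = prefactor n * ratio t"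
  have nz: "t \<noteq> 0" "t - 1 \<noteq> 0" "2 * t - 1 \<noteq> 0" "2 * t + 1 \<noteq> 0"
    unfolding t_def by (rule shifted_index_neq_0)+
  note rc = recurrence_coeffs[OF nz, folded M_def]
  have p1: "prefactor (Suc n) = K"
    by (simp add: prefactor_Suc t_def K_def)
  have t1: "of_nat (Suc n) + 2 = t + 1"
    by (simp add: t_def)
  have p2: "prefactor (Suc (Suc n)) = ratio (t + 1) * K"
    unfolding prefactor_Suc[of "Suc n"] p1 t1 ..
  have c: "- (M * a) * K + M * b * K + - (ratio t * M * d) * prefactor n = K * (M * (b - a - d))"
    for a b d
    unfolding K_def by (simp add: algebra_simps)
  have "prefactor (Suc (Suc n)) + atkin_alpha t * prefactor (Suc n) + atkin_beta t * prefactor n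
      = K * (M * (4 * (t\<^sup>2 - 29 / 144) * t\<^sup>2
          - (t + 7 / 12) * (t - 1 / 12) * (t + 1) * (2 * t - 1)
          - (t - 7 / 12) * (t + 1 / 12) * (t - 1) * (2 * t + 1)))"
    unfolding p1 p2 rc c ..
  also have "\<dots> = K * (M * (7 / 72 * (2 * t - 1) * (2 * t + 1)))"
    unfolding poly_identity_linear by (simp only: add_diff_cancel_left' diff_diff_eq)
  also have "M * (7 / 72 * (2 * t - 1) * (2 * t + 1)) = 7 / 144 / t\<^sup>2"
  proof -
    have "1 / (2 * t\<^sup>2 * a * b) * (7 / 72 * a * b) = 7 / 144 / t\<^sup>2" if "a \<noteq> 0" "b \<noteq> 0" for a b
      using that by simp
    then show ?thesis
      unfolding M_def recip_denom_def using nz by blast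
  qed
  finally show ?thesis
    unfolding p1 .
qed

section \<open>The three-term recurrence for the bracket\<close>

definition atkin_bracket :: "nat \<Rightarrow> complex \<Rightarrow> complex" where
  "atkin_bracket n x = - (5 / 12) * saal_sum n + (\<Sum>j\<le>n. bcoeff n j * phi j x)"

lemma atkin_bracket_recurrence:
  fixes n :: nat
  defines "t \<equiv> of_nat n + 2"
  shows "prefactor (Suc (Suc n)) * atkin_bracket (Suc (Suc n)) x
    = (x - atkin_alpha t) * (prefactor (Suc n) * atkin_bracket (Suc n) x)
      - atkin_beta t * (prefactor n * atkin_bracket n x)"
proof -
  define P where "P m = (\<Sum>j\<le>m. bcoeff m j * phi j x)" for m
  define q where "q = 7 / 144 / t\<^sup>2"
  define S where "S = (\<Sum>i\<le>Suc n. bcoeff (Suc n) i * weight (Suc i))"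
  have bz: "bcoeff m j = 0" if "m < j" for m j
    using that by (simp add: bcoeff_def pochhammer_neg_of_nat_eq_0)
  have b0: "bcoeff m 0 = 1" for m
    by (simp add: bcoeff_def)
  \<comment> \<open>Zero coefficients beyond \<open>m\<close> bring the three sums to one range, and
    \<open>j = 0\<close> is split off because its coefficient obeys a different relation.\<close>
  have P: "P m = x + (\<Sum>i\<le>Suc n. bcoeff m (Suc i) * phi (Suc i) x)" if "m \<le> Suc (Suc n)" for m
  proof -
    have "P m = (\<Sum>j\<le>Suc (Suc n). bcoeff m j * phi j x)"
      unfolding P_def using that by (intro sum.mono_neutral_left) (auto simp: bz)
    then show ?thesis
      by (simp only: sum.atMost_Suc_shift[of _ "Suc n"] b0 phi_0 mult_1_left)
  qed
  have "prefactor (Suc (Suc n)) * P (Suc (Suc n)) + atkin_alpha t * (prefactor (Suc n) * P (Suc n))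
        + atkin_beta t * (prefactor n * P n)
      = (prefactor (Suc (Suc n)) + atkin_alpha t * prefactor (Suc n) + atkin_beta t * prefactor n) * x
        + (\<Sum>i\<le>Suc n. (prefactor (Suc (Suc n)) * bcoeff (Suc (Suc n)) (Suc i)
            + atkin_alpha t * (prefactor (Suc n) * bcoeff (Suc n) (Suc i))
            + atkin_beta t * (prefactor n * bcoeff n (Suc i))) * phi (Suc i) x)"
    by (simp add: P distrib_left distrib_right sum.distrib sum_distrib_left mult.assoc
        del: sum.atMost_Suc)
  also have "\<dots> = prefactor (Suc n) * q * x
      + (\<Sum>i\<le>Suc n. prefactor (Suc n) * bcoeff (Suc n) i * phi (Suc i) x)"
    unfolding t_def linear_recurrence bcoeff_recurrence q_def ..
  also have "(\<Sum>i\<le>Suc n. prefactor (Suc n) * bcoeff (Suc n) i * phi (Suc i) x)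
      = prefactor (Suc n) * (x * P (Suc n) + x * S)"
    unfolding phi_Suc P_def S_def
    by (simp add: distrib_left sum.distrib sum_distrib_left ac_simps del: sum.atMost_Suc)
  \<comment> \<open>The \<open>- q\<close> removes the defect from \<open>linear_recurrence\<close>;
    the rest is \<open>x\<close> times the constant term of the bracket.\<close>
  also have "S = - q - 5 / 12 * saal_sum (Suc n)"
    using sum_bcoeff_weight[of "Suc n"] unfolding S_def t_def q_def
    by (simp add: eq_diff_eq add.commute del: sum.atMost_Suc)
  finally have main: "prefactor (Suc (Suc n)) * P (Suc (Suc n))
      + atkin_alpha t * (prefactor (Suc n) * P (Suc n)) + atkin_beta t * (prefactor n * P n)
      = x * (prefactor (Suc n) * (P (Suc n) - 5 / 12 * saal_sum (Suc n)))"
    by algebra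
  have Q: "atkin_bracket m x = P m - 5 / 12 * saal_sum m" for m
    by (simp add: atkin_bracket_def P_def)
  have "(prefactor (Suc (Suc n)) * P (Suc (Suc n))
      + atkin_alpha t * (prefactor (Suc n) * P (Suc n)) + atkin_beta t * (prefactor n * P n))
      - 5 / 12 * (prefactor (Suc (Suc n)) * saal_sum (Suc (Suc n))
      + atkin_alpha t * (prefactor (Suc n) * saal_sum (Suc n))
      + atkin_beta t * (prefactor n * saal_sum n))
      = x * (prefactor (Suc n) * (P (Suc n) - 5 / 12 * saal_sum (Suc n)))"
    unfolding main const_recurrence[of n, folded t_def] by simp
  then show ?thesis
    unfolding Q by algebra
qed

text \<open>Both sides obey the same recurrence. It first produces the polynomial of degree 3, so
  the base cases are degrees 1 and 2, given explicitly.\<close>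

lemma scaled_atkin_conv_bracket:
  "poly (scaled_atkin (Suc n)) x = prefactor n * atkin_bracket n x"
proof (induction n rule: induct_nat_012)
  case 0
  show ?case
    by (simp add: prefactor_def atkin_bracket_def saal_sum_def saal_term_def bcoeff_def phi_0)
next
  case 1
  show ?case
    by (simp add: prefactor_def atkin_bracket_def saal_sum_def saal_term_def bcoeff_def phi_Suc
        phi_0 weight_def pochhammer_rec field_simps)
next
  case (ge2 n)
  have t: "of_nat (n + 2) = complex_of_nat n + 2"
    by simp
  have "poly (scaled_atkin (Suc (Suc (Suc n)))) x
      = (x - atkin_alpha (of_nat n + 2)) * poly (scaled_atkin (Suc (Suc n))) x
        - atkin_beta (of_nat n + 2) * poly (scaled_atkin (Suc n)) x"
    unfolding scaled_atkin.simps Let_def t atkin_alpha_def[symmetric] atkin_beta_def[symmetric]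
    by (simp add: left_diff_distrib)
  then show ?case
    unfolding ge2 atkin_bracket_recurrence .
qed

section \<open>From the hypergeometric series to finite sums\<close>

lemma hypergeometric_terminating:
  "hypergeometric (- of_nat d # as) bs z =
     (\<Sum>m\<le>d. (\<Prod>a\<leftarrow>- of_nat d # as. pochhammer a m) / (\<Prod>b\<leftarrow>bs. pochhammer b m) * (z ^ m / fact m))"
  unfolding hypergeometric_def by (rule suminf_finite) (auto simp: pochhammer_neg_of_nat_eq_0)

lemma hypergeometric_eq_saal_sum:
  "hypergeometric [- of_nat n, of_nat n + 2, 7 / 12] [19 / 12, 2] 1 = saal_sum n"
  unfolding hypergeometric_terminating saal_sum_def
proof (rule sum.cong[OF refl])
  fix m
  have "pochhammer (7 / 12) m * (of_nat m + 7 / 12) = 7 / 12 * pochhammer (19 / 12 :: complex) m"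
    using pochhammer_rec[of "7 / 12 :: complex" m] by (simp add: pochhammer_Suc add.commute)
  then have p: "pochhammer (7 / 12) m / pochhammer (19 / 12) m
      = (7 / 12) / (of_nat m + 7 / 12 :: complex)"
    using of_nat_plus_fractions_neq_0(1)[of m] pochhammer_fraction_neq_0(2)[of m]
    by (simp only: frac_eq_eq not_False_eq_True)
  have q: "pochhammer 2 m = (fact (Suc m) :: complex)"
    unfolding pochhammer_fact pochhammer_rec by simp
  show "(\<Prod>a\<leftarrow>[- of_nat n, of_nat n + 2, 7 / 12]. pochhammer a m)
      / (\<Prod>b\<leftarrow>[19 / 12, 2]. pochhammer b m) * (1 ^ m / fact m) = saal_term n m"
    unfolding saal_term_def p[symmetric] by (simp add: q ac_simps del: fact_Suc)
qed

text \<open>By \<open>(a)_{k+m} = (a)_k * (a+k)_m\<close> the parameters shifted by \<open>k\<close>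
  merge with \<open>bcoeff n k\<close> into \<open>bcoeff n (k + m)\<close>; the remaining factors
  of both series add up to \<open>weight m\<close>.\<close>

lemma bcoeff_times_atkin_E:
  assumes "k \<le> n"
  shows "bcoeff n k * atkin_E n k = (\<Sum>m\<le>n - k. bcoeff n (k + m) * weight m)"
proof -
  have d: "of_nat k - of_nat n = - complex_of_nat (n - k)"
    using assms by (simp add: of_nat_diff)
  have "bcoeff n k * (6 / 5 * (pochhammer (of_nat k - of_nat n) m
          * (pochhammer (of_nat n + of_nat k + 2) m
          * (pochhammer (11 / 12) m * pochhammer (- (5 / 12)) m))
          / (pochhammer (of_nat k + 11 / 12) m * (pochhammer (of_nat k + 19 / 12) m
          * pochhammer 1 m)) / fact m)
        - 1 / 5 * (pochhammer (of_nat k - of_nat n) m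
          * (pochhammer (of_nat n + of_nat k + 2) m
          * (pochhammer (- (1 / 12)) m * pochhammer (- (5 / 12)) m))
          / (pochhammer (of_nat k + 11 / 12) m * (pochhammer (of_nat k + 19 / 12) m
          * pochhammer 1 m)) / fact m)) = bcoeff n (k + m) * weight m" for m
  proof -
    define w where "w = pochhammer (- (1 / 12) :: complex) m"
    define R where "R = bcoeff n k * (pochhammer (of_nat k - of_nat n) m
          * (pochhammer (of_nat n + of_nat k + 2) m * pochhammer (- (5 / 12)) m)
          / (pochhammer (of_nat k + 11 / 12) m * pochhammer (of_nat k + 19 / 12) m))
          / (fact m * fact m)"
    \<comment> \<open>Obtained by splitting \<open>(-1/12)_{m+1}\<close> once at its first and once
      at its last factor.\<close>
    have p: "pochhammer (11 / 12 :: complex) m = w * (1 - 12 * of_nat m)"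
      using pochhammer_rec[of "- (1 / 12) :: complex" m]
      by (simp add: pochhammer_Suc w_def field_simps)
    have e: "6 / 5 * pochhammer (11 / 12) m - 1 / 5 * w = w * (1 - 72 * of_nat m / 5)"
      unfolding p by (simp add: field_simps)
    have "bcoeff n (k + m) = bcoeff n k * (pochhammer (of_nat k - of_nat n) m
          * pochhammer (of_nat n + of_nat k + 2) m
          / (pochhammer (of_nat k + 11 / 12) m * pochhammer (of_nat k + 19 / 12) m))"
      by (simp add: bcoeff_def pochhammer_product' ac_simps)
    then have b: "bcoeff n (k + m) * weight m = R * (w * (1 - 72 * of_nat m / 5))"
      by (simp only: R_def weight_def w_def power2_eq_square times_divide_eq_right
          times_divide_eq_left divide_divide_eq_left ac_simps)
    show ?thesis
      unfolding b e[symmetric] unfolding w_def[symmetric] R_def pochhammer_fact[symmetric]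
      by (simp only: right_diff_distrib times_divide_eq_right times_divide_eq_left
          divide_divide_eq_left diff_divide_distrib mult_1_left ac_simps)
  qed
  then show ?thesis
    unfolding atkin_E_def d hypergeometric_terminating
    by (simp add: sum_distrib_left sum_subtractf[symmetric] mult.assoc)
qed

lemma atkin_bracket_eq:
  "- (5 / 12) * hypergeometric [- of_nat n, of_nat n + 2, 7 / 12] [19 / 12, 2] 1
     + (\<Sum>k = 0..n. bcoeff n k * x ^ (k + 1) * atkin_E n k) = atkin_bracket n x"
proof -
  have "(\<Sum>k = 0..n. bcoeff n k * x ^ (k + 1) * atkin_E n k)
      = (\<Sum>k\<le>n. \<Sum>m\<le>n - k. bcoeff n (k + m) * weight m * x ^ (k + 1))"
  proof (rule sum.cong)
    fix k assume "k \<in> {..n}"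
    then have "bcoeff n k * atkin_E n k = (\<Sum>m\<le>n - k. bcoeff n (k + m) * weight m)"
      by (intro bcoeff_times_atkin_E) simp
    then show "bcoeff n k * x ^ (k + 1) * atkin_E n k
        = (\<Sum>m\<le>n - k. bcoeff n (k + m) * weight m * x ^ (k + 1))"
      by (simp only: sum_distrib_right[symmetric]) (simp add: ac_simps)
  qed auto
  also have "\<dots> = (\<Sum>(k, m)\<in>{(k, m). k + m \<le> n}. bcoeff n (k + m) * weight m * x ^ (k + 1))"
    unfolding sum.Sigma[OF finite_atMost ballI[OF finite_atMost]]
    by (rule sum.cong) auto
  \<comment> \<open>The swap puts \<open>m\<close> first, so that the diagonal reindexing keeps
    \<open>m\<close> as inner variable and replaces \<open>k\<close> by \<open>j - m\<close>, as in
    \<open>phi\<close>.\<close>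
  also have "\<dots> = (\<Sum>(m, k)\<in>{(m, k). m + k \<le> n}. bcoeff n (m + k) * weight m * x ^ (k + 1))"
    by (rule sum.reindex_bij_witness[of _ prod.swap prod.swap]) (auto simp: add.commute)
  also have "\<dots> = (\<Sum>j\<le>n. \<Sum>m\<le>j. bcoeff n (m + (j - m)) * weight m * x ^ (j - m + 1))"
    by (rule sum.triangle_reindex_eq)
  also have "\<dots> = (\<Sum>j\<le>n. bcoeff n j * phi j x)"
    unfolding phi_def by (auto simp: sum_distrib_left mult.assoc intro!: sum.cong)
  finally show ?thesis
    by (simp add: atkin_bracket_def hypergeometric_eq_saal_sum)
qed

theorem theorem4p1:
  fixes n :: nat and x :: complex
  shows "poly (scaled_atkin (n + 1)) x =
    pochhammer (19 / 12) n * pochhammer (11 / 12) n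
      / (pochhammer (of_nat n + 2) n * pochhammer (- of_nat n) n)
    * (- (5 / 12) * hypergeometric [- of_nat n, of_nat n + 2, 7 / 12] [19 / 12, 2] 1
       + (\<Sum>k = 0..n. pochhammer (- of_nat n) k * pochhammer (of_nat n + 2) k
            / (pochhammer (19 / 12) k * pochhammer (11 / 12) k) * x ^ (k + 1) * atkin_E n k))"
  using scaled_atkin_conv_bracket[of n x]
  unfolding atkin_bracket_eq[symmetric] prefactor_def bcoeff_def by simp

end
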